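(* Let $(k,g)$ satisfy the general conditions (GC), let $x_0>0$, and assume that the convolution equations $(\phi,g)$ and $(\psi,g)$ associated with $k$ and $x_0$ have positive solutions $u_\phi$ and $u_\psi$ on $[0,x_0]$, which are unique and global attractors. Let $u_{\max}$ and $u_{\min}$ denote the maximum and the minimum positive solution on $[0,x_0]$ of the equation $(k,g)$. Then: 1. for every measurable function $f$ on $[0,x_0]$ with $f\ge u_{\max}$, the sequence $(T_{kg}^n f)_{n\in\mathbb{N}}$ converges pointwise on $[0,x_0]$ to $u_{\max}$; 2. for every positive measurable function $f$ on $[0,x_0]$ with $f\le u_{\min}$, the sequence $(T_{kg}^n f)_{n\in\mathbb{N}}$ converges pointwise on $[0,x_0]$ to $u_{\min}$.
   Context: General conditions (GC) on a pair $(k,g)$: - (K1) $k:\mathbb{R}^2\to[0,\infty)$ is a (measurable) locally bounded function with $k(x,s)=0$ whenever $s>x$. - (K2) For every $x\in\mathbb{R}$ the map $s\mapsto k(x,s)$ is locally integrable, and $K(x)=\int_0^x k(x,s)\,ds$, $x\ge 0$, is strictly increasing. - (G1) $g:\mathbb{R}\to[0,\infty)$ is continuous, vanishes on $(-\infty,0]$, is strictly increasing on $[0,\infty)$, and $g'>0$ almost everywhere on $(0,\infty)$. For $x\in[0,x_0]$, $$\phi(x)=\min\{k((1-\lambda)x+\lambda x_0,\lambda(x_0-x)):\lambda\in[0,1]\},\quad \psi(x)=\max\{k((1-\lambda)x+\lambda x_0,\lambda(x_0-x)):\lambda\in[0,1]\};$$ it is presupposed that these exist and are measurable in $x$. One has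 $\phi(x-s)\le k(x,s)\le\psi(x-s)$ for $0\le s\le x\le x_0$. Operators on functions on $[0,x_0]$: $T_{kg}f(x)=\int_0^x k(x,s)g(f(s))\,ds$, $T_{\phi g}f(x)=\int_0^x\phi(x-s)g(f(s))\,ds$, and $T_{\psi g}$ likewise; $T^n$ is the $n$-fold composition. The equation $(k,g)$ is $u=T_{kg}u$, and $(\phi,g)$, $(\psi,g)$ are $u=T_{\phi g}u$, $u=T_{\psi g}u$. All functions considered are measurable and bounded on $[0,x_0]$. A function is positive if it is $>0$ on $(0,x_0]$; solutions are positive solutions on $[0,x_0]$. "$u_\phi$ is a global attractor" means that $T_{\phi g}^nf\to u_\phi$ pointwise on $[0,x_0]$ for every positive measurable (bounded) $f$; similarly for $u_\psi$ with $T_{\psi g}$. The maximum (minimum) solution of $(k,g)$ is the positive solution on $[0,x_0]$ that is pointwise $\ge$ ($\le$) every other positive solution on $[0,x_0]$; both exist in this setting. *)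

theory Defs
  imports "HOL-Analysis.Analysis"
begin

text \<open>
  Measurability and integrals are in the sense of Lebesgue. A function on an interval
  \<open>[0, x0]\<close> is represented by a total function on the reals of which only the values on
  \<open>{0..x0}\<close> matter.
\<close>

definition general_conditions :: "(real \<Rightarrow> real \<Rightarrow> real) \<Rightarrow> (real \<Rightarrow> real) \<Rightarrow> bool" where
  "general_conditions k g \<longleftrightarrow>
     (\<lambda>(x, s). k x s) \<in> borel_measurable lebesgue \<and>
     (\<forall>x s. 0 \<le> k x s) \<and>
     (\<forall>C. compact C \<longrightarrow> bounded ((\<lambda>(x, s). k x s) ` C)) \<and>
     (\<forall>x s. x < s \<longrightarrow> k x s = 0) \<and>
     (\<forall>x C. compact C \<longrightarrow> set_integrable lebesgue C (\<lambda>s. k x s)) \<and>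
     strict_mono_on {0..} (\<lambda>x. LINT s:{0..x}|lebesgue. k x s) \<and>
     continuous_on UNIV g \<and>
     (\<forall>x. 0 \<le> g x) \<and>
     (\<forall>x\<le>0. g x = 0) \<and>
     strict_mono_on {0..} g \<and>
     (AE x in lebesgue. 0 < x \<longrightarrow> (\<exists>d>0. (g has_real_derivative d) (at x)))"

text \<open>
  For \<open>x < x0\<close> the points \<open>(y, s)\<close> occurring here are those with \<open>y - s = x\<close> and
  \<open>0 \<le> s\<close>, \<open>y \<le> x0\<close>.
\<close>

definition diagonal_values :: "(real \<Rightarrow> real \<Rightarrow> real) \<Rightarrow> real \<Rightarrow> real \<Rightarrow> real set" where
  "diagonal_values k x0 x =
     (\<lambda>l. k ((1 - l) * x + l * x0) (l * (x0 - x))) ` {0..1}"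

text \<open>
  The minimum and the maximum need not exist for an arbitrary kernel; the two definitions
  below are meaningful only together with \<open>has_convolution_bounds\<close>.
\<close>

definition phi :: "(real \<Rightarrow> real \<Rightarrow> real) \<Rightarrow> real \<Rightarrow> real \<Rightarrow> real" where
  "phi k x0 x = (LEAST y. y \<in> diagonal_values k x0 x)"

definition psi :: "(real \<Rightarrow> real \<Rightarrow> real) \<Rightarrow> real \<Rightarrow> real \<Rightarrow> real" where
  "psi k x0 x = (GREATEST y. y \<in> diagonal_values k x0 x)"

definition has_convolution_bounds :: "(real \<Rightarrow> real \<Rightarrow> real) \<Rightarrow> real \<Rightarrow> bool" where
  "has_convolution_bounds k x0 \<longleftrightarrow>
     (\<forall>x\<in>{0..x0}. \<exists>m\<in>diagonal_values k x0 x. \<forall>y\<in>diagonal_values k x0 x. m \<le> y) \<and>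
     (\<forall>x\<in>{0..x0}. \<exists>m\<in>diagonal_values k x0 x. \<forall>y\<in>diagonal_values k x0 x. y \<le> m) \<and>
     phi k x0 \<in> borel_measurable (lebesgue_on {0..x0}) \<and>
     psi k x0 \<in> borel_measurable (lebesgue_on {0..x0})"

definition volterra_op ::
    "(real \<Rightarrow> real \<Rightarrow> real) \<Rightarrow> (real \<Rightarrow> real) \<Rightarrow> (real \<Rightarrow> real) \<Rightarrow> real \<Rightarrow> real" where
  "volterra_op k g f x = (LINT s:{0..x}|lebesgue. k x s * g (f s))"

definition convolution_kernel :: "(real \<Rightarrow> real) \<Rightarrow> real \<Rightarrow> real \<Rightarrow> real" where
  "convolution_kernel p x s = p (x - s)"

definition bounded_measurable_on :: "real \<Rightarrow> (real \<Rightarrow> real) \<Rightarrow> bool" where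
  "bounded_measurable_on x0 f \<longleftrightarrow>
     f \<in> borel_measurable (lebesgue_on {0..x0}) \<and> bounded (f ` {0..x0})"

definition positive_on :: "real \<Rightarrow> (real \<Rightarrow> real) \<Rightarrow> bool" where
  "positive_on x0 f \<longleftrightarrow> (\<forall>x\<in>{0<..x0}. 0 < f x)"

definition positive_solution ::
    "(real \<Rightarrow> real \<Rightarrow> real) \<Rightarrow> (real \<Rightarrow> real) \<Rightarrow> real \<Rightarrow> (real \<Rightarrow> real) \<Rightarrow> bool" where
  "positive_solution k g x0 u \<longleftrightarrow>
     bounded_measurable_on x0 u \<and> positive_on x0 u \<and>
     (\<forall>x\<in>{0..x0}. u x = volterra_op k g u x)"

definition unique_positive_solution ::
    "(real \<Rightarrow> real \<Rightarrow> real) \<Rightarrow> (real \<Rightarrow> real) \<Rightarrow> real \<Rightarrow> (real \<Rightarrow> real) \<Rightarrow> bool" where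
  "unique_positive_solution k g x0 u \<longleftrightarrow>
     positive_solution k g x0 u \<and>
     (\<forall>v. positive_solution k g x0 v \<longrightarrow> (\<forall>x\<in>{0..x0}. v x = u x))"

definition global_attractor ::
    "(real \<Rightarrow> real \<Rightarrow> real) \<Rightarrow> (real \<Rightarrow> real) \<Rightarrow> real \<Rightarrow> (real \<Rightarrow> real) \<Rightarrow> bool" where
  "global_attractor k g x0 u \<longleftrightarrow>
     (\<forall>f. bounded_measurable_on x0 f \<and> positive_on x0 f \<longrightarrow>
        (\<forall>x\<in>{0..x0}. (\<lambda>n. (volterra_op k g ^^ n) f x) \<longlonglongrightarrow> u x))"

definition maximum_solution ::
    "(real \<Rightarrow> real \<Rightarrow> real) \<Rightarrow> (real \<Rightarrow> real) \<Rightarrow> real \<Rightarrow> (real \<Rightarrow> real) \<Rightarrow> bool" where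
  "maximum_solution k g x0 u \<longleftrightarrow>
     positive_solution k g x0 u \<and>
     (\<forall>v. positive_solution k g x0 v \<longrightarrow> (\<forall>x\<in>{0..x0}. v x \<le> u x))"

definition minimum_solution ::
    "(real \<Rightarrow> real \<Rightarrow> real) \<Rightarrow> (real \<Rightarrow> real) \<Rightarrow> real \<Rightarrow> (real \<Rightarrow> real) \<Rightarrow> bool" where
  "minimum_solution k g x0 u \<longleftrightarrow>
     positive_solution k g x0 u \<and>
     (\<forall>v. positive_solution k g x0 v \<longrightarrow> (\<forall>x\<in>{0..x0}. u x \<le> v x))"

end

theory Submission imports Defs begin

text \<open>
  Write \<open>T\<close> for the operator of the equation \<open>(k, g)\<close>. It is monotone, it is continuous along
  uniformly bounded pointwise convergent sequences, and it lies between the two convolution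
  operators with kernels \<open>\<phi>\<close> and \<open>\<psi>\<close>.

  Start from \<open>f \<ge> u_max\<close>. All iterates stay above \<open>u_max\<close>, so only their pointwise upper limit
  \<open>F\<close> has to be bounded. Monotonicity gives \<open>sup {T\<^sup>m f | m > n} \<le> T (sup {T\<^sup>m f | m \<ge> n})\<close>,
  and letting \<open>n\<close> grow shows \<open>F \<le> T F\<close> (\<open>upper_limit_subsolution\<close>). The iterates of \<open>F\<close>
  therefore increase. Their limit is a positive solution above \<open>F\<close>, hence below \<open>u_max\<close> by
  maximality, so \<open>F \<le> u_max\<close> (\<open>iterates_tendsto_maximum_solution\<close>). From below the argument is
  dual: the lower limit \<open>F\<close> satisfies \<open>T F \<le> F\<close>, its iterates decrease to a solution, and
  minimality gives \<open>u_min \<le> F\<close> (\<open>iterates_tendsto_minimum_solution\<close>).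

  The convolution equations supply what this scheme does not provide by itself. From above,
  dominated convergence needs a bound for the iterates that is uniform in \<open>n\<close> and \<open>x\<close>. The
  attractor property of \<open>u_\<psi>\<close> is only pointwise, but a convolution operator maps increasing
  functions to increasing functions, so the \<open>\<psi>\<close>-iterates of a constant are largest at \<open>x0\<close>, and
  there they converge (\<open>convolution_iterates_bounded\<close>). From below, the limit solution must not
  degenerate to zero: the \<open>\<phi>\<close>-iterates stay below those of \<open>T\<close> and converge to the positive
  function \<open>u_\<phi>\<close>.

  The one delicate point of measure theory is that \<open>T f\<close> is measurable when \<open>k\<close> is only Lebesgue
  measurable in the plane (\<open>volterra_op_measurable\<close>).
\<close>

section \<open>Bounded measurable functions on an interval\<close>
lemma borel_representative_on_lebesgue:
  fixes f :: "real \<Rightarrow> real"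
  assumes "f \<in> borel_measurable (lebesgue_on {a..b})"
  obtains f' where "f' \<in> borel_measurable lborel"
    and "AE s in lborel. s \<in> {a..b} \<longrightarrow> f s = f' s"
proof -
  have "(\<lambda>s. indicator {a..b} s *\<^sub>R f s) \<in> borel_measurable lebesgue"
    using assms by (subst (asm) borel_measurable_restrict_space_iff) auto
  then obtain f' where f': "f' \<in> borel_measurable lborel"
      "AE s in lborel. indicator {a..b} s *\<^sub>R f s = f' s"
    using completion_ex_borel_measurable_real by blast
  have "AE s in lborel. s \<in> {a..b} \<longrightarrow> f s = f' s"
    using f'(2) by eventually_elim (auto simp: indicator_def)
  with f'(1) that show ?thesis by blast
qed

lemma bounded_measurable_onI:
  assumes "f \<in> borel_measurable (lebesgue_on {0..x0})"
    and "\<And>x. 0 \<le> x \<Longrightarrow> x \<le> x0 \<Longrightarrow> \<bar>f x\<bar> \<le> B"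
  shows "bounded_measurable_on x0 f"
  unfolding bounded_measurable_on_def bounded_iff
  using assms by (auto intro!: exI[of _ B])

lemma bounded_measurable_onE:
  assumes "bounded_measurable_on x0 f"
  obtains B where "f \<in> borel_measurable (lebesgue_on {0..x0})" "0 < B"
    "\<And>x. 0 \<le> x \<Longrightarrow> x \<le> x0 \<Longrightarrow> \<bar>f x\<bar> \<le> B"
  using assms unfolding bounded_measurable_on_def bounded_pos by fastforce

lemma positive_on_mono:
  assumes "positive_on x0 u" "\<And>x. 0 \<le> x \<Longrightarrow> x \<le> x0 \<Longrightarrow> u x \<le> v x"
  shows "positive_on x0 v"
  unfolding positive_on_def
proof
  fix x assume "x \<in> {0<..x0}"
  then have "0 < u x" "u x \<le> v x"
    using assms by (auto simp: positive_on_def)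
  then show "0 < v x" by (rule less_le_trans)
qed

section \<open>Volterra operators with a bounded kernel\<close>

text \<open>
  Only the triangle \<open>0 \<le> s \<le> x \<le> x0\<close> matters. Measurability is required section by section only:
  for a convolution kernel this follows from measurability of one function of one variable.
\<close>
locale bounded_volterra =
  fixes p :: "real \<Rightarrow> real \<Rightarrow> real" and g :: "real \<Rightarrow> real" and x0 C :: real
  assumes kernel_nonneg: "0 \<le> s \<Longrightarrow> s \<le> x \<Longrightarrow> x \<le> x0 \<Longrightarrow> 0 \<le> p x s"
    and kernel_le: "0 \<le> s \<Longrightarrow> s \<le> x \<Longrightarrow> x \<le> x0 \<Longrightarrow> p x s \<le> C"
    and kernel_section: "0 \<le> x \<Longrightarrow> x \<le> x0 \<Longrightarrow> p x \<in> borel_measurable (lebesgue_on {0..x})"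
    and g_continuous: "continuous_on UNIV g"
    and g_nonneg: "0 \<le> g y"
    and g_mono: "y \<le> z \<Longrightarrow> g y \<le> g z"
begin

abbreviation T :: "(real \<Rightarrow> real) \<Rightarrow> real \<Rightarrow> real" where
  "T \<equiv> volterra_op p g"

lemma volterra_op_eq: "volterra_op q g f x = (LINT s|lebesgue_on {0..x}. q x s * g (f s))"
  unfolding volterra_op_def set_lebesgue_integral_def
  by (subst integral_restrict_space) auto

lemma integrand_measurable:
  assumes "f \<in> borel_measurable (lebesgue_on {0..x0})" "0 \<le> x" "x \<le> x0"
  shows "(\<lambda>s. p x s * g (f s)) \<in> borel_measurable (lebesgue_on {0..x})"
proof -
  have "f \<in> borel_measurable (lebesgue_on {0..x})"
    using assms by (auto intro: measurable_restrict_mono)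
  moreover have "g \<in> borel_measurable borel"
    using g_continuous by (rule borel_measurable_continuous_onI)
  ultimately show ?thesis
    using kernel_section[OF assms(2,3)] by measurable
qed

lemma integrand_bound:
  assumes "\<And>s. 0 \<le> s \<Longrightarrow> s \<le> x0 \<Longrightarrow> f s \<le> B" "0 \<le> s" "s \<le> x" "x \<le> x0"
  shows "0 \<le> p x s * g (f s)" "p x s * g (f s) \<le> C * g B"
  using assms kernel_nonneg[of s x] kernel_le[of s x] g_nonneg g_mono[of "f s" B]
  by (auto intro!: mult_mono)

lemma finite_measure_Icc: "finite_measure (lebesgue_on {0..x::real})"
  by (rule finite_measure_lebesgue_on) auto

lemma integrand_integrable:
  assumes f: "f \<in> borel_measurable (lebesgue_on {0..x0})"
    and B: "\<And>s. 0 \<le> s \<Longrightarrow> s \<le> x0 \<Longrightarrow> f s \<le> B"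
    and x: "0 \<le> x" "x \<le> x0"
  shows "integrable (lebesgue_on {0..x}) (\<lambda>s. p x s * g (f s))"
  using integrand_bound[of f B _ x, OF B _ _ x(2)]
  by (intro finite_measure.integrable_const_bound[where B = "C * g B"] finite_measure_Icc
      integrand_measurable f x AE_I2) auto

lemma volterra_op_nonneg:
  assumes "0 \<le> x" "x \<le> x0"
  shows "0 \<le> T f x"
  unfolding volterra_op_eq
  by (intro integral_nonneg_AE AE_I2) (use assms kernel_nonneg g_nonneg in auto)

lemma volterra_op_bounded:
  assumes B: "\<And>s. 0 \<le> s \<Longrightarrow> s \<le> x0 \<Longrightarrow> f s \<le> B" and x: "0 \<le> x" "x \<le> x0"
  shows "\<bar>T f x\<bar> \<le> C * g B * x0"
proof -
  have C: "0 \<le> C * g B"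
    using kernel_nonneg[of 0 0] kernel_le[of 0 0] g_nonneg[of B] x by auto
  have "T f x \<le> (LINT s|lebesgue_on {0..x}. C * g B)"
    unfolding volterra_op_eq
    by (rule integral_mono') (use C integrand_bound[of f B _ x, OF B _ _ x(2)] in auto)
  also have "\<dots> = C * g B * x"
    using x by (simp add: measure_restrict_space)
  also have "\<dots> \<le> C * g B * x0"
    using C x by (intro mult_left_mono) auto
  finally show ?thesis
    using volterra_op_nonneg[OF x, of f] by simp
qed

text \<open>
  The smaller integrand may fail to be integrable: its integral is then \<open>0\<close>, which is still below
  the larger one. The lower bounds by the kernel \<open>\<phi>\<close> rely on this, as the iterates of its operator
  are compared with those of \<open>T\<close> for functions whose \<open>\<phi>\<close>-iterates are only known pointwise.
\<close>
lemma volterra_op_comparison: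
  assumes q: "\<And>x s. 0 \<le> s \<Longrightarrow> s \<le> x \<Longrightarrow> x \<le> x0 \<Longrightarrow> q x s \<le> p x s"
    and le: "\<And>s. 0 \<le> s \<Longrightarrow> s \<le> x0 \<Longrightarrow> f s \<le> h s"
    and h: "bounded_measurable_on x0 h"
    and x: "0 \<le> x" "x \<le> x0"
  shows "volterra_op q g f x \<le> T h x"
proof -
  obtain B where B: "h \<in> borel_measurable (lebesgue_on {0..x0})"
      "\<And>s. 0 \<le> s \<Longrightarrow> s \<le> x0 \<Longrightarrow> \<bar>h s\<bar> \<le> B"
    using bounded_measurable_onE[OF h] by metis
  have ub: "\<And>s. 0 \<le> s \<Longrightarrow> s \<le> x0 \<Longrightarrow> h s \<le> B"
    using B(2) by (meson abs_le_D1)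
  show ?thesis
    unfolding volterra_op_eq
  proof (rule integral_mono')
    show "integrable (lebesgue_on {0..x}) (\<lambda>s. p x s * g (h s))"
      by (rule integrand_integrable[OF B(1) ub x])
  next
    fix s assume "s \<in> space (lebesgue_on {0..x})"
    then have s: "0 \<le> s" "s \<le> x" "s \<le> x0" using x by auto
    show "0 \<le> p x s * g (h s)"
      using kernel_nonneg[OF s(1,2) x(2)] g_nonneg by simp
    have "q x s * g (f s) \<le> p x s * g (f s)"
      using q[OF s(1,2) x(2)] g_nonneg by (rule mult_right_mono)
    also have "\<dots> \<le> p x s * g (h s)"
      using le[OF s(1,3)] kernel_nonneg[OF s(1,2) x(2)] by (intro mult_left_mono g_mono)
    finally show "q x s * g (f s) \<le> p x s * g (h s)" .
  qed
qed

lemma volterra_op_mono: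
  assumes "\<And>s. 0 \<le> s \<Longrightarrow> s \<le> x0 \<Longrightarrow> f s \<le> h s" "bounded_measurable_on x0 h" "0 \<le> x" "x \<le> x0"
  shows "T f x \<le> T h x"
  by (rule volterra_op_comparison) (use assms in auto)

lemma iterates_comparison:
  assumes q: "\<And>x s. 0 \<le> s \<Longrightarrow> s \<le> x \<Longrightarrow> x \<le> x0 \<Longrightarrow> q x s \<le> p x s"
    and le: "\<And>s. 0 \<le> s \<Longrightarrow> s \<le> x0 \<Longrightarrow> f s \<le> h s"
    and h: "\<And>n. bounded_measurable_on x0 ((T ^^ n) h)"
  shows "0 \<le> x \<Longrightarrow> x \<le> x0 \<Longrightarrow> (volterra_op q g ^^ n) f x \<le> (T ^^ n) h x"
proof (induction n arbitrary: x)
  case 0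
  then show ?case using le by simp
next
  case (Suc n)
  show ?case
    using volterra_op_comparison[OF q Suc.IH h Suc.prems] by simp
qed

text \<open>
  Dominated convergence with a constant majorant; as \<open>g\<close> is nonnegative and increasing, an upper
  bound of the functions suffices.
\<close>
lemma volterra_op_tendsto:
  assumes h: "\<And>n. h n \<in> borel_measurable (lebesgue_on {0..x0})"
    and B: "\<And>n s. 0 \<le> s \<Longrightarrow> s \<le> x0 \<Longrightarrow> h n s \<le> B"
    and lim: "\<And>s. 0 \<le> s \<Longrightarrow> s \<le> x0 \<Longrightarrow> (\<lambda>n. h n s) \<longlonglongrightarrow> F s"
    and x: "0 \<le> x" "x \<le> x0"
  shows "(\<lambda>n. T (h n) x) \<longlonglongrightarrow> T F x"
proof -
  have F: "F \<in> borel_measurable (lebesgue_on {0..x0})"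
    by (rule borel_measurable_LIMSEQ_metric[OF h]) (use lim in auto)
  have g_cont: "isCont g y" for y
    using g_continuous by (simp add: continuous_on_eq_continuous_at)
  show ?thesis
    unfolding volterra_op_eq
  proof (rule integral_dominated_convergence[where w = "\<lambda>_. C * g B"])
    show "integrable (lebesgue_on {0..x}) (\<lambda>_. C * g B)"
      using finite_measure_Icc by (simp add: finite_measure.integrable_const)
    show "AE s in lebesgue_on {0..x}. (\<lambda>n. p x s * g (h n s)) \<longlonglongrightarrow> p x s * g (F s)"
      by (intro AE_I2 tendsto_mult tendsto_const isCont_tendsto_compose[OF g_cont] lim)
        (use x in auto)
    show "AE s in lebesgue_on {0..x}. norm (p x s * g (h n s)) \<le> C * g B" for n
      using integrand_bound[of "h n" B _ x, OF B _ _ x(2)] by (intro AE_I2) auto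
  qed (use h F x in \<open>auto intro: integrand_measurable\<close>)
qed

text \<open>
  The kernel \<open>p\<close> and the function \<open>f\<close> agree almost everywhere with Borel functions \<open>p'\<close> and
  \<open>f'\<close>. By Fubini, for almost every \<open>x\<close> the sections \<open>p x\<close> and \<open>p' (x, _)\<close> agree almost
  everywhere, so \<open>T f\<close> agrees almost everywhere with the parameter integral \<open>G\<close> of a Borel
  function, which is Borel. Completeness of Lebesgue measure carries this over to \<open>T f\<close>.
\<close>
lemma volterra_op_measurable:
  assumes joint: "(\<lambda>(x, s). p x s) \<in> borel_measurable lebesgue"
    and f: "f \<in> borel_measurable (lebesgue_on {0..x0})"
  shows "T f \<in> borel_measurable (lebesgue_on {0..x0})"
proof -
  obtain p' where p': "p' \<in> borel_measurable lborel"
      "AE z in lborel. (\<lambda>(x, s). p x s) z = p' z"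
    using completion_ex_borel_measurable_real[OF joint] by blast
  have "AE x in lborel. AE s in lborel. (\<lambda>(x, s). p x s) (x, s) = p' (x, s)"
    using p'(2) unfolding lborel_prod[symmetric] by (rule lborel_pair.AE_pair)
  then have p_eq: "AE x in lborel. AE s in lborel. p x s = p' (x, s)"
    by simp
  obtain f' where f': "f' \<in> borel_measurable lborel"
      "AE s in lborel. s \<in> {0..x0} \<longrightarrow> f s = f' s"
    using borel_representative_on_lebesgue[OF f] .
  have g [measurable]: "g \<in> borel_measurable borel"
    using g_continuous by (rule borel_measurable_continuous_onI)
  have [measurable]: "p' \<in> borel_measurable borel" "f' \<in> borel_measurable borel"
    using p'(1) f'(1) by auto
  define G where "G x = (LINT s|lborel. indicator {0..x} s * (p' (x, s) * g (f' s)))" for x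
  have slice: "(\<lambda>s. p' (x, s)) \<in> borel_measurable borel" for x
    by measurable
  have "(\<lambda>(x, s). indicator {0..x} s * (p' (x, s) * g (f' s)))
      \<in> borel_measurable (borel \<Otimes>\<^sub>M (lborel :: real measure))"
    unfolding indicator_def atLeastAtMost_iff by measurable
  then have "G \<in> borel_measurable borel"
    unfolding G_def by (rule lborel.borel_measurable_lebesgue_integral)
  then have G: "(\<lambda>x. indicator {0..x0} x * G x) \<in> borel_measurable lebesgue"
    by (intro measurable_completion) measurable
  have "AE x in lborel. indicator {0..x0} x * G x = indicator {0..x0} x * T f x"
    using p_eq
  proof eventually_elim
    fix x assume px: "AE s in lborel. p x s = p' (x, s)"
    show "indicator {0..x0} x * G x = indicator {0..x0} x * T f x"
    proof (cases "x \<in> {0..x0}")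
      case True
      then have x: "0 \<le> x" "x \<le> x0" by auto
      have "T f x = (LINT s|lebesgue. indicator {0..x} s *\<^sub>R (p x s * g (f s)))"
        by (simp add: volterra_op_def set_lebesgue_integral_def)
      also have "\<dots> = (LINT s|lebesgue. indicator {0..x} s * (p' (x, s) * g (f' s)))"
      proof (rule integral_cong_AE)
        show "(\<lambda>s. indicator {0..x} s *\<^sub>R (p x s * g (f s))) \<in> borel_measurable lebesgue"
          using integrand_measurable[OF f x]
          by (subst (asm) borel_measurable_restrict_space_iff) auto
        show "(\<lambda>s. indicator {0..x} s * (p' (x, s) * g (f' s))) \<in> borel_measurable lebesgue"
          using slice by (intro measurable_completion) measurable
        have "AE s in lborel. indicator {0..x} s *\<^sub>R (p x s * g (f s))
            = indicator {0..x} s * (p' (x, s) * g (f' s))"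
          using px f'(2) by eventually_elim (use x in \<open>auto simp: indicator_def\<close>)
        then show "AE s in lebesgue. indicator {0..x} s *\<^sub>R (p x s * g (f s))
            = indicator {0..x} s * (p' (x, s) * g (f' s))"
          by (rule AE_completion)
      qed
      also have "\<dots> = G x"
        unfolding G_def using slice by (intro integral_completion) measurable
      finally show ?thesis by simp
    qed simp
  qed
  then have "AE x in lebesgue. indicator {0..x0} x * G x = indicator {0..x0} x * T f x"
    by (rule AE_completion)
  then have "(\<lambda>x. indicator {0..x0} x * T f x) \<in> borel_measurable lebesgue"
    by (rule borel_measurable_AE[OF G])
  then show ?thesis
    by (subst borel_measurable_restrict_space_iff) auto
qed

end

section \<open>Convolution kernels\<close>
locale convolution_volterra = bounded_volterra "convolution_kernel b" g x0 C
  for b :: "real \<Rightarrow> real" and g :: "real \<Rightarrow> real" and x0 C :: real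
begin

lemma convolution_kernel_pointwise:
  assumes "0 \<le> t" "t \<le> x0"
  shows "0 \<le> b t"
  using kernel_nonneg[of 0 t] assms by (simp add: convolution_kernel_def)

lemma convolution_op_reflect:
  "T f x = (LINT t|lebesgue_on {0..x}. b t * g (f (x - t)))"
proof -
  have "T f x = (LINT s|lebesgue. indicator {0..x} s *\<^sub>R (b (x - s) * g (f s)))"
    by (simp add: volterra_op_def set_lebesgue_integral_def convolution_kernel_def)
  also have "\<dots> = (LINT t|lebesgue. indicator {0..x} (x - t) *\<^sub>R (b t * g (f (x - t))))"
    by (subst lebesgue_integral_real_affine[where c = "-1" and t = x]) auto
  also have "\<dots> = (LINT t|lebesgue. indicator {0..x} t *\<^sub>R (b t * g (f (x - t))))"
    by (rule Bochner_Integration.integral_cong) (auto simp: indicator_def)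
  also have "\<dots> = (LINT t|lebesgue_on {0..x}. b t * g (f (x - t)))"
    by (subst integral_restrict_space) auto
  finally show ?thesis .
qed

lemma convolution_integrand_integrable:
  assumes f: "f \<in> borel_measurable (lebesgue_on {0..x0})"
    and B: "\<And>s. 0 \<le> s \<Longrightarrow> s \<le> x0 \<Longrightarrow> f s \<le> B"
    and x: "0 \<le> x" "x \<le> x0"
  shows "integrable (lebesgue_on {0..x}) (\<lambda>t. b t * g (f (x - t)))"
proof -
  let ?F = "\<lambda>s. indicator {0..x} s *\<^sub>R (b (x - s) * g (f s))"
  have "integrable (lebesgue_on {0..x}) (\<lambda>s. convolution_kernel b x s * g (f s))"
    by (rule integrand_integrable[OF f B x])
  then have "integrable lebesgue ?F"
    by (subst (asm) integrable_restrict_space) (auto simp: convolution_kernel_def)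
  then have "integrable lebesgue (\<lambda>t. ?F (x + (-1) * t))"
    by (rule lebesgue_integrable_real_affine) simp
  also have "(\<lambda>t. ?F (x + (-1) * t)) = (\<lambda>t. indicator {0..x} t *\<^sub>R (b t * g (f (x - t))))"
    by (auto simp: indicator_def)
  finally show ?thesis
    by (subst integrable_restrict_space) auto
qed

text \<open>
  After the reflection \<open>t = x - s\<close> the kernel no longer depends on \<open>x\<close>: enlarging \<open>x\<close>
  enlarges both the domain of integration and the integrand.
\<close>
lemma convolution_op_mono_on:
  assumes f: "mono_on {0..x0} f" and meas: "f \<in> borel_measurable (lebesgue_on {0..x0})"
  shows "mono_on {0..x0} (T f)"
proof (rule mono_onI)
  fix x y assume xy: "x \<in> {0..x0}" "y \<in> {0..x0}" "x \<le> y"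
  have f_le: "f s \<le> f x0" if "0 \<le> s" "s \<le> x0" for s
    using f that by (auto intro: mono_onD)
  have int_y: "integrable lebesgue (\<lambda>t. indicator {0..y} t *\<^sub>R (b t * g (f (y - t))))"
  proof -
    have "integrable (lebesgue_on {0..y}) (\<lambda>t. b t * g (f (y - t)))"
      by (rule convolution_integrand_integrable[OF meas f_le]) (use xy in auto)
    then show ?thesis
      by (subst (asm) integrable_restrict_space) auto
  qed
  have "T f x = (LINT t|lebesgue. indicator {0..x} t *\<^sub>R (b t * g (f (x - t))))"
    unfolding convolution_op_reflect by (subst integral_restrict_space) auto
  also have "\<dots> \<le> (LINT t|lebesgue. indicator {0..y} t *\<^sub>R (b t * g (f (y - t))))"
  proof (rule integral_mono'[OF int_y])
    fix t :: real
    show "0 \<le> indicator {0..y} t *\<^sub>R (b t * g (f (y - t)))"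
      using xy convolution_kernel_pointwise[of t] g_nonneg by (auto simp: indicator_def)
    show "indicator {0..x} t *\<^sub>R (b t * g (f (x - t)))
        \<le> indicator {0..y} t *\<^sub>R (b t * g (f (y - t)))"
    proof (cases "t \<in> {0..x}")
      case True
      then have "f (x - t) \<le> f (y - t)"
        using xy by (intro mono_onD[OF f]) auto
      then show ?thesis
        using True xy convolution_kernel_pointwise[of t]
        by (auto simp: indicator_def intro!: mult_left_mono g_mono)
    next
      case False
      then show ?thesis
        using xy convolution_kernel_pointwise[of t] g_nonneg by (auto simp: indicator_def)
    qed
  qed
  also have "\<dots> = T f y"
    unfolding convolution_op_reflect by (subst integral_restrict_space) auto
  finally show "T f x \<le> T f y" .
qed

lemma convolution_iterates_of_constant:
  "mono_on {0..x0} ((T ^^ n) (\<lambda>_. M)) \<and> bounded_measurable_on x0 ((T ^^ n) (\<lambda>_. M))"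
proof (induction n)
  case 0
  show ?case
    by (auto simp: mono_on_def intro!: bounded_measurable_onI)
next
  case (Suc n)
  let ?h = "(T ^^ n) (\<lambda>_. M)"
  obtain B where B: "?h \<in> borel_measurable (lebesgue_on {0..x0})"
      "\<And>x. 0 \<le> x \<Longrightarrow> x \<le> x0 \<Longrightarrow> \<bar>?h x\<bar> \<le> B"
    using bounded_measurable_onE Suc by metis
  have mono: "mono_on {0..x0} (T ?h)"
    using Suc B(1) by (intro convolution_op_mono_on) auto
  have "T ?h \<in> borel_measurable (restrict_space borel {0..x0})"
    by (rule borel_measurable_mono_on_fnc[OF mono])
  then have "T ?h \<in> borel_measurable (lebesgue_on {0..x0})"
    by (subst (asm) borel_measurable_restrict_space_iff, simp,
        subst borel_measurable_restrict_space_iff, simp) (auto intro: measurable_completion)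
  moreover have "\<bar>T ?h x\<bar> \<le> C * g B * x0" if "0 \<le> x" "x \<le> x0" for x
    using B(2) by (intro volterra_op_bounded that) (meson abs_le_D1)
  ultimately have "bounded_measurable_on x0 (T ?h)"
    by (rule bounded_measurable_onI)
  with mono show ?case by simp
qed

text \<open>
  Convergence at the single point \<open>x0\<close> gives a uniform bound, because every iterate is largest
  there.
\<close>
lemma convolution_iterates_bounded:
  assumes "convergent (\<lambda>n. (T ^^ n) (\<lambda>_. M) x0)"
  obtains B where "\<And>n x. 0 \<le> x \<Longrightarrow> x \<le> x0 \<Longrightarrow> (T ^^ n) (\<lambda>_. M) x \<le> B"
proof -
  obtain B where B: "\<And>n. norm ((T ^^ n) (\<lambda>_. M) x0) \<le> B"
    using convergent_imp_Bseq[OF assms] unfolding Bseq_def by blast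
  have "(T ^^ n) (\<lambda>_. M) x \<le> B" if "0 \<le> x" "x \<le> x0" for n x
  proof -
    have "(T ^^ n) (\<lambda>_. M) x \<le> (T ^^ n) (\<lambda>_. M) x0"
      using convolution_iterates_of_constant[of n M] that by (auto intro: mono_onD)
    also have "\<dots> \<le> B"
      using B[of n] by simp
    finally show ?thesis .
  qed
  with that show ?thesis by blast
qed

end

section \<open>Limits of iterates\<close>

text \<open>
  Joint measurability of the kernel makes the operator map bounded measurable functions to such
  functions, so that it can be iterated.
\<close>
locale joint_volterra = bounded_volterra p g x0 C
  for p :: "real \<Rightarrow> real \<Rightarrow> real" and g :: "real \<Rightarrow> real" and x0 C :: real +
  assumes joint: "(\<lambda>(x, s). p x s) \<in> borel_measurable lebesgue"
begin

lemma volterra_op_bounded_measurable: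
  assumes "bounded_measurable_on x0 f"
  shows "bounded_measurable_on x0 (T f)"
proof -
  obtain B where B: "f \<in> borel_measurable (lebesgue_on {0..x0})"
      "\<And>x. 0 \<le> x \<Longrightarrow> x \<le> x0 \<Longrightarrow> \<bar>f x\<bar> \<le> B"
    using bounded_measurable_onE[OF assms] by metis
  have "\<bar>T f x\<bar> \<le> C * g B * x0" if "0 \<le> x" "x \<le> x0" for x
    using B(2) by (intro volterra_op_bounded that) (meson abs_le_D1)
  then show ?thesis
    by (intro bounded_measurable_onI volterra_op_measurable joint B(1))
qed

lemma iterates_bounded_measurable:
  "bounded_measurable_on x0 f \<Longrightarrow> bounded_measurable_on x0 ((T ^^ n) f)"
  by (induction n) (auto intro: volterra_op_bounded_measurable)

lemma iterates_nonneg: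
  assumes "\<And>x. 0 \<le> x \<Longrightarrow> x \<le> x0 \<Longrightarrow> 0 \<le> f x" "0 \<le> x" "x \<le> x0"
  shows "0 \<le> (T ^^ n) f x"
  using assms volterra_op_nonneg by (cases n) auto

lemma subsolution_iterates_incseq:
  assumes F: "bounded_measurable_on x0 F"
    and sub: "\<And>x. 0 \<le> x \<Longrightarrow> x \<le> x0 \<Longrightarrow> F x \<le> T F x"
    and x: "0 \<le> x" "x \<le> x0"
  shows "incseq (\<lambda>n. (T ^^ n) F x)"
proof -
  have "(T ^^ n) F x \<le> (T ^^ n) (T F) x" for n
    by (rule iterates_comparison)
      (use sub x F in \<open>auto intro: iterates_bounded_measurable volterra_op_bounded_measurable\<close>)
  then show ?thesis
    by (intro incseq_SucI) (metis funpow_swap1 funpow.simps(2) comp_apply)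
qed

lemma supersolution_iterates_decseq:
  assumes F: "bounded_measurable_on x0 F"
    and super: "\<And>x. 0 \<le> x \<Longrightarrow> x \<le> x0 \<Longrightarrow> T F x \<le> F x"
    and x: "0 \<le> x" "x \<le> x0"
  shows "decseq (\<lambda>n. (T ^^ n) F x)"
proof -
  have "(T ^^ n) (T F) x \<le> (T ^^ n) F x" for n
    by (rule iterates_comparison)
      (use super x F in \<open>auto intro: iterates_bounded_measurable\<close>)
  then show ?thesis
    by (intro decseq_SucI) (metis funpow_swap1 funpow.simps(2) comp_apply)
qed

lemma limit_of_iterates_fixed:
  assumes f: "bounded_measurable_on x0 f"
    and B: "\<And>n x. 0 \<le> x \<Longrightarrow> x \<le> x0 \<Longrightarrow> \<bar>(T ^^ n) f x\<bar> \<le> B"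
    and lim: "\<And>x. 0 \<le> x \<Longrightarrow> x \<le> x0 \<Longrightarrow> (\<lambda>n. (T ^^ n) f x) \<longlonglongrightarrow> v x"
  shows "bounded_measurable_on x0 v" "0 \<le> x \<Longrightarrow> x \<le> x0 \<Longrightarrow> v x = T v x"
proof -
  have meas: "(T ^^ n) f \<in> borel_measurable (lebesgue_on {0..x0})" for n
    using iterates_bounded_measurable[OF f, of n] by (simp add: bounded_measurable_on_def)
  show "bounded_measurable_on x0 v"
  proof (rule bounded_measurable_onI)
    show "v \<in> borel_measurable (lebesgue_on {0..x0})"
      by (rule borel_measurable_LIMSEQ_metric[OF meas]) (use lim in auto)
    show "\<bar>v x\<bar> \<le> B" if "0 \<le> x" "x \<le> x0" for x
      using tendsto_rabs[OF lim[OF that]] B[OF that] by (intro LIMSEQ_le_const2) auto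
  qed
  assume x: "0 \<le> x" "x \<le> x0"
  have "(\<lambda>n. T ((T ^^ n) f) x) \<longlonglongrightarrow> T v x"
    using B by (intro volterra_op_tendsto[where B = B] meas lim x) (meson abs_le_D1)
  moreover have "(\<lambda>n. T ((T ^^ n) f) x) \<longlonglongrightarrow> v x"
    using LIMSEQ_Suc[OF lim[OF x]] by simp
  ultimately show "v x = T v x"
    using LIMSEQ_unique by blast
qed

text \<open>
  Each iterate of index at least \<open>n + 1\<close> is the image of one of index at least \<open>n\<close>, hence lies
  below the image of the supremum \<open>S n\<close> of the latter. Thus \<open>S (Suc n) \<le> T (S n)\<close>, and the
  inequality passes to the limit of the decreasing sequence \<open>S\<close>. This limit is the pointwise
  upper limit of the iterates.
\<close>
lemma upper_limit_subsolution:
  assumes f: "bounded_measurable_on x0 f"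
    and B: "\<And>n x. 0 \<le> x \<Longrightarrow> x \<le> x0 \<Longrightarrow> \<bar>(T ^^ n) f x\<bar> \<le> B"
  obtains F where "bounded_measurable_on x0 F"
    and "\<And>x. 0 \<le> x \<Longrightarrow> x \<le> x0 \<Longrightarrow> F x \<le> T F x"
    and "\<And>x. 0 \<le> x \<Longrightarrow> x \<le> x0 \<Longrightarrow> (\<lambda>n. SUP m\<in>{n..}. (T ^^ m) f x) \<longlonglongrightarrow> F x"
proof -
  define S where "S n x = (SUP m\<in>{n..}. (T ^^ m) f x)" for n x
  have bdd: "bdd_above ((\<lambda>m. (T ^^ m) f x) ` {n..})" if "0 \<le> x" "x \<le> x0" for n x
    using B[OF that] by (intro bdd_aboveI2[where M = B]) (meson abs_le_D1)
  have S_ge: "(T ^^ m) f x \<le> S n x" if "n \<le> m" "0 \<le> x" "x \<le> x0" for m n x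
    unfolding S_def using that by (intro cSUP_upper bdd) auto
  have S_upper: "S n x \<le> B" if "0 \<le> x" "x \<le> x0" for n x
    unfolding S_def using B[OF that] by (intro cSUP_least) (auto intro: abs_le_D1)
  have S_lower: "- B \<le> S n x" if "0 \<le> x" "x \<le> x0" for n x
    using S_ge[of n n x] B[OF that, of n] that by (auto simp: abs_le_iff)
  have S_meas: "S n \<in> borel_measurable (lebesgue_on {0..x0})" for n
    unfolding S_def
  proof (rule borel_measurable_cSUP)
    show "(T ^^ m) f \<in> borel_measurable (lebesgue_on {0..x0})" for m
      using iterates_bounded_measurable[OF f, of m] by (simp add: bounded_measurable_on_def)
  qed (use bdd in auto)
  have S_bm: "bounded_measurable_on x0 (S n)" for n
    using S_upper S_lower by (intro bounded_measurable_onI[OF S_meas, where B = B]) (simp add: abs_le_iff minus_le_iff)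
  have S_dec: "decseq (\<lambda>n. S n x)" if "0 \<le> x" "x \<le> x0" for x
    unfolding S_def decseq_def using bdd[OF that] by (auto intro!: cSUP_subset_mono)
  define F where "F x = lim (\<lambda>n. S n x)" for x
  have S_lim: "(\<lambda>n. S n x) \<longlonglongrightarrow> F x" if "0 \<le> x" "x \<le> x0" for x
    using decseq_convergent[OF S_dec[OF that], of "- B"] S_lower[OF that]
    unfolding F_def by (metis convergentI convergent_LIMSEQ_iff)
  have S_step: "S (Suc n) x \<le> T (S n) x" if "0 \<le> x" "x \<le> x0" for n x
    unfolding S_def[of "Suc n"]
  proof (rule cSUP_least)
    fix m assume "m \<in> {Suc n..}"
    then obtain l where l: "m = Suc l" "n \<le> l" by (cases m) auto
    have "T ((T ^^ l) f) x \<le> T (S n) x"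
      by (rule volterra_op_mono) (use S_ge l S_bm that in auto)
    then show "(T ^^ m) f x \<le> T (S n) x"
      using l by simp
  qed simp
  have "bounded_measurable_on x0 F"
  proof (rule bounded_measurable_onI)
    show "F \<in> borel_measurable (lebesgue_on {0..x0})"
      by (rule borel_measurable_LIMSEQ_metric[OF S_meas]) (use S_lim in auto)
    show "\<bar>F x\<bar> \<le> B" if "0 \<le> x" "x \<le> x0" for x
      using LIMSEQ_le_const[OF S_lim[OF that], of "- B"] LIMSEQ_le_const2[OF S_lim[OF that], of B]
        S_upper[OF that] S_lower[OF that] by auto
  qed
  moreover have "F x \<le> T F x" if "0 \<le> x" "x \<le> x0" for x
  proof (rule LIMSEQ_le)
    show "(\<lambda>n. S (Suc n) x) \<longlonglongrightarrow> F x"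
      using S_lim[OF that] by (rule LIMSEQ_Suc)
    show "(\<lambda>n. T (S n) x) \<longlonglongrightarrow> T F x"
      by (rule volterra_op_tendsto[OF S_meas S_upper S_lim that])
  qed (use S_step that in auto)
  ultimately show ?thesis
    using that S_lim unfolding S_def by blast
qed

text \<open>The dual statement: the infima satisfy \<open>T (S n) \<le> S (Suc n)\<close> and increase.\<close>
lemma lower_limit_supersolution:
  assumes f: "bounded_measurable_on x0 f"
    and B: "\<And>n x. 0 \<le> x \<Longrightarrow> x \<le> x0 \<Longrightarrow> \<bar>(T ^^ n) f x\<bar> \<le> B"
  obtains F where "bounded_measurable_on x0 F"
    and "\<And>x. 0 \<le> x \<Longrightarrow> x \<le> x0 \<Longrightarrow> T F x \<le> F x"
    and "\<And>x. 0 \<le> x \<Longrightarrow> x \<le> x0 \<Longrightarrow> (\<lambda>n. INF m\<in>{n..}. (T ^^ m) f x) \<longlonglongrightarrow> F x"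
proof -
  define S where "S n x = (INF m\<in>{n..}. (T ^^ m) f x)" for n x
  have bdd: "bdd_below ((\<lambda>m. (T ^^ m) f x) ` {n..})" if "0 \<le> x" "x \<le> x0" for n x
    using B[OF that] by (intro bdd_belowI2[where m = "- B"]) (simp add: abs_le_iff minus_le_iff)
  have S_le: "S n x \<le> (T ^^ m) f x" if "n \<le> m" "0 \<le> x" "x \<le> x0" for m n x
    unfolding S_def using that by (intro cINF_lower bdd) auto
  have S_lower: "- B \<le> S n x" if "0 \<le> x" "x \<le> x0" for n x
    unfolding S_def using B[OF that] by (intro cINF_greatest) (auto simp: abs_le_iff minus_le_iff)
  have S_upper: "S n x \<le> B" if "0 \<le> x" "x \<le> x0" for n x
    using S_le[of n n x] B[OF that, of n] that by (auto simp: abs_le_iff)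
  have S_meas: "S n \<in> borel_measurable (lebesgue_on {0..x0})" for n
    unfolding S_def
  proof (rule borel_measurable_cINF)
    show "(T ^^ m) f \<in> borel_measurable (lebesgue_on {0..x0})" for m
      using iterates_bounded_measurable[OF f, of m] by (simp add: bounded_measurable_on_def)
  qed (use bdd in auto)
  have S_inc: "incseq (\<lambda>n. S n x)" if "0 \<le> x" "x \<le> x0" for x
    unfolding S_def incseq_def using bdd[OF that] by (auto intro!: cINF_superset_mono)
  define F where "F x = lim (\<lambda>n. S n x)" for x
  have S_lim: "(\<lambda>n. S n x) \<longlonglongrightarrow> F x" if "0 \<le> x" "x \<le> x0" for x
    using incseq_convergent[OF S_inc[OF that], of B] S_upper[OF that]
    unfolding F_def by (metis convergentI convergent_LIMSEQ_iff)
  have S_step: "T (S n) x \<le> S (Suc n) x" if "0 \<le> x" "x \<le> x0" for n x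
    unfolding S_def[of "Suc n"]
  proof (rule cINF_greatest)
    fix m assume "m \<in> {Suc n..}"
    then obtain l where l: "m = Suc l" "n \<le> l" by (cases m) auto
    have "T (S n) x \<le> T ((T ^^ l) f) x"
      by (rule volterra_op_mono) (use S_le l iterates_bounded_measurable[OF f] that in auto)
    then show "T (S n) x \<le> (T ^^ m) f x"
      using l by simp
  qed simp
  have "bounded_measurable_on x0 F"
  proof (rule bounded_measurable_onI)
    show "F \<in> borel_measurable (lebesgue_on {0..x0})"
      by (rule borel_measurable_LIMSEQ_metric[OF S_meas]) (use S_lim in auto)
    show "\<bar>F x\<bar> \<le> B" if "0 \<le> x" "x \<le> x0" for x
      using LIMSEQ_le_const[OF S_lim[OF that], of "- B"] LIMSEQ_le_const2[OF S_lim[OF that], of B]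
        S_upper[OF that] S_lower[OF that] by auto
  qed
  moreover have "T F x \<le> F x" if "0 \<le> x" "x \<le> x0" for x
  proof (rule LIMSEQ_le)
    show "(\<lambda>n. S (Suc n) x) \<longlonglongrightarrow> F x"
      using S_lim[OF that] by (rule LIMSEQ_Suc)
    show "(\<lambda>n. T (S n) x) \<longlonglongrightarrow> T F x"
      by (rule volterra_op_tendsto[OF S_meas S_upper S_lim that])
  qed (use S_step that in auto)
  ultimately show ?thesis
    using that S_lim unfolding S_def by blast
qed

text \<open>
  The upper limit \<open>F\<close> of the iterates is a subsolution above \<open>u\<close>. Its own iterates increase to a
  positive solution \<open>v\<close>, so \<open>u \<le> F \<le> v \<le> u\<close>. The boundedness hypothesis is used twice, for
  \<open>f\<close> and for \<open>F\<close>.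
\<close>
lemma iterates_tendsto_maximum_solution:
  assumes iterates_bounded: "\<And>f. bounded_measurable_on x0 f
      \<Longrightarrow> \<exists>B. \<forall>n x. 0 \<le> x \<longrightarrow> x \<le> x0 \<longrightarrow> (T ^^ n) f x \<le> B"
    and max_sol: "maximum_solution p g x0 u"
    and f: "bounded_measurable_on x0 f"
    and ge: "\<And>x. 0 \<le> x \<Longrightarrow> x \<le> x0 \<Longrightarrow> u x \<le> f x"
    and x: "0 \<le> x" "x \<le> x0"
  shows "(\<lambda>n. (T ^^ n) f x) \<longlonglongrightarrow> u x"
proof -
  have u: "bounded_measurable_on x0 u" "positive_on x0 u"
    "\<And>x. 0 \<le> x \<Longrightarrow> x \<le> x0 \<Longrightarrow> T u x = u x"
    and max: "\<And>v x. positive_solution p g x0 v \<Longrightarrow> 0 \<le> x \<Longrightarrow> x \<le> x0 \<Longrightarrow> v x \<le> u x"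
    using max_sol by (auto simp: maximum_solution_def positive_solution_def)
  have u_nonneg: "0 \<le> u x" if "0 \<le> x" "x \<le> x0" for x
    using volterra_op_nonneg[OF that, of u] u(3)[OF that] by simp
  have iter_ge: "u x \<le> (T ^^ n) f x" if "0 \<le> x" "x \<le> x0" for n x
    using that
  proof (induction n arbitrary: x)
    case (Suc n)
    have "T u x \<le> T ((T ^^ n) f) x"
      using Suc by (intro volterra_op_mono iterates_bounded_measurable f) auto
    then show ?case using u(3) Suc.prems by simp
  qed (use ge in simp)
  obtain B where B: "\<And>n x. 0 \<le> x \<Longrightarrow> x \<le> x0 \<Longrightarrow> (T ^^ n) f x \<le> B"
    using iterates_bounded[OF f] by blast
  have abs_B: "\<bar>(T ^^ n) f x\<bar> \<le> B" if "0 \<le> x" "x \<le> x0" for n x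
    using B[OF that, of n] iter_ge[OF that, of n] u_nonneg[OF that] by simp
  obtain F where F: "bounded_measurable_on x0 F" "\<And>x. 0 \<le> x \<Longrightarrow> x \<le> x0 \<Longrightarrow> F x \<le> T F x"
    "\<And>x. 0 \<le> x \<Longrightarrow> x \<le> x0 \<Longrightarrow> (\<lambda>n. SUP m\<in>{n..}. (T ^^ m) f x) \<longlonglongrightarrow> F x"
    using upper_limit_subsolution[OF f abs_B] by blast
  have sup_ge: "(T ^^ n) f x \<le> (SUP m\<in>{n..}. (T ^^ m) f x)" if "0 \<le> x" "x \<le> x0" for n x
    using B[OF that] by (intro cSUP_upper bdd_aboveI2[where M = B]) auto
  have F_ge: "u x \<le> F x" if "0 \<le> x" "x \<le> x0" for x
    using sup_ge[OF that] iter_ge[OF that] order_trans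
    by (intro LIMSEQ_le_const[OF F(3)[OF that]]) blast
  obtain B' where B': "\<And>n x. 0 \<le> x \<Longrightarrow> x \<le> x0 \<Longrightarrow> (T ^^ n) F x \<le> B'"
    using iterates_bounded[OF F(1)] by blast
  have inc: "incseq (\<lambda>n. (T ^^ n) F x)" if "0 \<le> x" "x \<le> x0" for x
    by (rule subsolution_iterates_incseq[OF F(1,2) that])
  define v where "v x = lim (\<lambda>n. (T ^^ n) F x)" for x
  have v: "(\<lambda>n. (T ^^ n) F x) \<longlonglongrightarrow> v x" if "0 \<le> x" "x \<le> x0" for x
    using incseq_convergent[OF inc[OF that], of B'] B'[OF that]
    unfolding v_def by (metis convergentI convergent_LIMSEQ_iff)
  have F_le_v: "F x \<le> v x" if "0 \<le> x" "x \<le> x0" for x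
    using incseq_le[OF inc[OF that] v[OF that], of 0] by simp
  have abs_B': "\<bar>(T ^^ n) F x\<bar> \<le> B'" if "0 \<le> x" "x \<le> x0" for n x
  proof -
    have "0 \<le> (T ^^ n) F x"
      by (rule iterates_nonneg[OF _ that]) (use F_ge u_nonneg order_trans in blast)
    with B'[OF that, of n] show ?thesis by simp
  qed
  have "positive_on x0 v"
    by (rule positive_on_mono[OF u(2)]) (use F_ge F_le_v order_trans in blast)
  then have "positive_solution p g x0 v"
    unfolding positive_solution_def
    using limit_of_iterates_fixed[OF F(1) abs_B' v] by auto
  then have "F x \<le> u x"
    using max F_le_v x order_trans by blast
  then have lim: "(\<lambda>n. SUP m\<in>{n..}. (T ^^ m) f x) \<longlonglongrightarrow> u x"
    using F_ge[OF x] F(3)[OF x] by simp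
  show ?thesis
    by (rule tendsto_sandwich[OF _ _ tendsto_const lim]) (use iter_ge[OF x] sup_ge[OF x] in auto)
qed

text \<open>
  The lower limit \<open>F\<close> of the iterates is a supersolution below \<open>u\<close>, and its iterates decrease to
  a solution \<open>v\<close>. Minimality of \<open>u\<close> applies only to a positive \<open>v\<close>. This is where the smaller
  kernel \<open>q\<close> enters, twice: comparison with the \<open>q\<close>-iterates of \<open>f\<close> shows that \<open>F\<close> is positive,
  which makes \<open>F\<close> an admissible starting function for the attractor, and comparison with the
  \<open>q\<close>-iterates of \<open>F\<close> then gives \<open>w \<le> v\<close>.
\<close>
lemma iterates_tendsto_minimum_solution:
  assumes q_le: "\<And>x s. 0 \<le> s \<Longrightarrow> s \<le> x \<Longrightarrow> x \<le> x0 \<Longrightarrow> q x s \<le> p x s"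
    and attractor: "global_attractor q g x0 w" and w: "positive_on x0 w"
    and min_sol: "minimum_solution p g x0 u"
    and f: "bounded_measurable_on x0 f" and pos: "positive_on x0 f"
    and le: "\<And>x. 0 \<le> x \<Longrightarrow> x \<le> x0 \<Longrightarrow> f x \<le> u x"
    and x: "0 \<le> x" "x \<le> x0"
  shows "(\<lambda>n. (T ^^ n) f x) \<longlonglongrightarrow> u x"
proof -
  let ?Tq = "volterra_op q g"
  have u: "bounded_measurable_on x0 u"
    "\<And>x. 0 \<le> x \<Longrightarrow> x \<le> x0 \<Longrightarrow> T u x = u x"
    and min: "\<And>v x. positive_solution p g x0 v \<Longrightarrow> 0 \<le> x \<Longrightarrow> x \<le> x0 \<Longrightarrow> u x \<le> v x"
    using min_sol by (auto simp: minimum_solution_def positive_solution_def)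
  have iter_le: "(T ^^ n) f x \<le> u x" if "0 \<le> x" "x \<le> x0" for n x
    using that
  proof (induction n arbitrary: x)
    case (Suc n)
    have "T ((T ^^ n) f) x \<le> T u x"
      using Suc by (intro volterra_op_mono u) auto
    then show ?case using u(2) Suc.prems by simp
  qed (use le in simp)
  have q_iter: "(?Tq ^^ n) h x \<le> (T ^^ n) h x"
    if "bounded_measurable_on x0 h" "0 \<le> x" "x \<le> x0" for n h x
    using that q_le by (intro iterates_comparison iterates_bounded_measurable) auto
  have q_lim: "(\<lambda>n. (?Tq ^^ n) h x) \<longlonglongrightarrow> w x"
    if "bounded_measurable_on x0 h" "positive_on x0 h" "0 \<le> x" "x \<le> x0" for h x
    using attractor that by (auto simp: global_attractor_def)
  have w_pos: "0 < w x" if "0 < x" "x \<le> x0" for x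
    using w that by (simp add: positive_on_def)
  (* The iterates lie between 0 and u, except that f 0 may be negative: B0 covers that value. *)
  obtain B0 where B0: "\<And>x. 0 \<le> x \<Longrightarrow> x \<le> x0 \<Longrightarrow> \<bar>f x\<bar> \<le> B0"
    using bounded_measurable_onE[OF f] by metis
  obtain B1 where B1: "\<And>x. 0 \<le> x \<Longrightarrow> x \<le> x0 \<Longrightarrow> \<bar>u x\<bar> \<le> B1"
    using bounded_measurable_onE[OF u(1)] by metis
  have abs_B: "\<bar>(T ^^ n) f x\<bar> \<le> max B0 B1" if "0 \<le> x" "x \<le> x0" for n x
  proof (cases n)
    case 0
    then show ?thesis using B0[OF that] by simp
  next
    case (Suc m)
    then have "0 \<le> (T ^^ n) f x" using volterra_op_nonneg[OF that] by simp
    then show ?thesis using iter_le[OF that, of n] B1[OF that] by simp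
  qed
  obtain F where F: "bounded_measurable_on x0 F" "\<And>x. 0 \<le> x \<Longrightarrow> x \<le> x0 \<Longrightarrow> T F x \<le> F x"
    "\<And>x. 0 \<le> x \<Longrightarrow> x \<le> x0 \<Longrightarrow> (\<lambda>n. INF m\<in>{n..}. (T ^^ m) f x) \<longlonglongrightarrow> F x"
    using lower_limit_supersolution[OF f abs_B] by blast
  have inf_le: "(INF m\<in>{n..}. (T ^^ m) f x) \<le> (T ^^ n) f x" if "0 \<le> x" "x \<le> x0" for n x
    using abs_B[OF that]
    by (intro cINF_lower bdd_belowI2[where m = "- max B0 B1"]) (auto simp: abs_le_iff minus_le_iff)
  have F_le: "F x \<le> u x" if "0 \<le> x" "x \<le> x0" for x
    using inf_le[OF that] iter_le[OF that] order_trans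
    by (intro LIMSEQ_le_const2[OF F(3)[OF that]]) blast
  have F_pos: "positive_on x0 F"
    unfolding positive_on_def
  proof
    fix x assume "x \<in> {0<..x0}"
    then have x: "0 \<le> x" "x \<le> x0" "0 < x" by auto
    (* Any number strictly between 0 and w x would do in place of w x / 2. *)
    have "w x / 2 < w x"
      using w_pos[OF x(3,2)] by simp
    then have "\<forall>\<^sub>F n in sequentially. w x / 2 < (?Tq ^^ n) f x"
      by (rule order_tendstoD(1)[OF q_lim[OF f pos x(1,2)]])
    then obtain N where N: "\<And>n. N \<le> n \<Longrightarrow> w x / 2 < (?Tq ^^ n) f x"
      by (auto simp: eventually_sequentially)
    have "w x / 2 \<le> (INF m\<in>{n..}. (T ^^ m) f x)" if "N \<le> n" for n
    proof (rule cINF_greatest)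
      fix m assume "m \<in> {n..}"
      then show "w x / 2 \<le> (T ^^ m) f x"
        using N[of m] q_iter[OF f x(1,2), of m] that by auto
    qed simp
    then have "w x / 2 \<le> F x"
      by (intro LIMSEQ_le_const[OF F(3)[OF x(1,2)]]) blast
    then show "0 < F x"
      using w_pos[OF x(3,2)] by simp
  qed
  have T_nonneg: "0 \<le> (T ^^ n) F x" if "0 \<le> x" "x \<le> x0" for n x
  proof (rule iterates_nonneg[OF _ that])
    show "0 \<le> F x" if "0 \<le> x" "x \<le> x0" for x
      using F(2)[OF that] volterra_op_nonneg[OF that, of F] by simp
  qed
  have dec: "decseq (\<lambda>n. (T ^^ n) F x)" if "0 \<le> x" "x \<le> x0" for x
    by (rule supersolution_iterates_decseq[OF F(1,2) that])
  define v where "v x = lim (\<lambda>n. (T ^^ n) F x)" for x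
  have v: "(\<lambda>n. (T ^^ n) F x) \<longlonglongrightarrow> v x" if "0 \<le> x" "x \<le> x0" for x
    using decseq_convergent[OF dec[OF that], of 0] T_nonneg[OF that]
    unfolding v_def by (metis convergentI convergent_LIMSEQ_iff)
  have v_le_F: "v x \<le> F x" if "0 \<le> x" "x \<le> x0" for x
    using decseq_ge[OF dec[OF that] v[OF that], of 0] by simp
  have abs_B1: "\<bar>(T ^^ n) F x\<bar> \<le> B1" if "0 \<le> x" "x \<le> x0" for n x
    using T_nonneg[OF that, of n] decseqD[OF dec[OF that], of 0 n] F_le[OF that] B1[OF that]
    by simp
  have "w x \<le> v x" if "0 \<le> x" "x \<le> x0" for x
    by (rule LIMSEQ_le[OF q_lim[OF F(1) F_pos that] v[OF that]])
      (use q_iter[OF F(1) that] in auto)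
  then have "positive_on x0 v"
    by (rule positive_on_mono[OF w])
  then have "positive_solution p g x0 v"
    unfolding positive_solution_def
    using limit_of_iterates_fixed[OF F(1) abs_B1 v] by auto
  then have "u x \<le> F x"
    using min v_le_F x order_trans by blast
  then have lim: "(\<lambda>n. INF m\<in>{n..}. (T ^^ m) f x) \<longlonglongrightarrow> u x"
    using F_le[OF x] F(3)[OF x] by simp
  show ?thesis
    by (rule tendsto_sandwich[OF _ _ lim tendsto_const]) (use iter_le[OF x] inf_le[OF x] in auto)
qed

end

section \<open>The convolution bounds of a kernel\<close>
lemma phi_psi_extremal:
  assumes "has_convolution_bounds k x0" "0 \<le> t" "t \<le> x0" "y \<in> diagonal_values k x0 t"
  shows "phi k x0 t \<le> y" "y \<le> psi k x0 t"
    and "phi k x0 t \<in> diagonal_values k x0 t" "psi k x0 t \<in> diagonal_values k x0 t"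
proof -
  have t: "t \<in> {0..x0}" using assms by simp
  obtain m where m: "m \<in> diagonal_values k x0 t" "\<And>z. z \<in> diagonal_values k x0 t \<Longrightarrow> m \<le> z"
    using assms(1) t unfolding has_convolution_bounds_def by blast
  obtain M where M: "M \<in> diagonal_values k x0 t" "\<And>z. z \<in> diagonal_values k x0 t \<Longrightarrow> z \<le> M"
    using assms(1) t unfolding has_convolution_bounds_def by blast
  have "phi k x0 t = m" "psi k x0 t = M"
    unfolding phi_def psi_def using m M by (auto intro: Least_equality Greatest_equality)
  with m M assms(4) show "phi k x0 t \<le> y" "y \<le> psi k x0 t"
      "phi k x0 t \<in> diagonal_values k x0 t" "psi k x0 t \<in> diagonal_values k x0 t"
    by auto
qed

text \<open>
  The point \<open>(x, s)\<close> lies on the segment with parameter \<open>l = s / (x0 - (x - s))\<close>. When the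
  denominator vanishes, \<open>s = 0\<close> and the segment is a single point.
\<close>
lemma kernel_value_on_diagonal:
  assumes "0 \<le> s" "s \<le> x" "x \<le> x0"
  shows "k x s \<in> diagonal_values k x0 (x - s)"
proof -
  obtain l where l: "0 \<le> l" "l \<le> 1" "l * (x0 - (x - s)) = s"
  proof (cases "x0 - (x - s) = 0")
    case True
    then have "s = 0" using assms by auto
    with True that[of 0] show ?thesis by simp
  next
    case False
    then have pos: "0 < x0 - (x - s)" using assms by auto
    show ?thesis
      by (rule that[of "s / (x0 - (x - s))"]) (use pos assms in \<open>auto simp: divide_simps\<close>)
  qed
  have "(1 - l) * (x - s) + l * x0 = (x - s) + l * (x0 - (x - s))"
    by (simp add: algebra_simps)
  also have "\<dots> = x" using l(3) by simp
  finally have "k x s = k ((1 - l) * (x - s) + l * x0) (l * (x0 - (x - s)))"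
    using l(3) by simp
  with l(1,2) show ?thesis
    unfolding diagonal_values_def by (intro image_eqI[where x = l]) auto
qed

lemma diagonal_values_subset:
  assumes "0 \<le> t" "t \<le> x0"
  shows "diagonal_values k x0 t \<subseteq> (\<lambda>(x, s). k x s) ` ({0..x0} \<times> {0..x0})"
proof
  fix y assume "y \<in> diagonal_values k x0 t"
  then obtain l where l: "0 \<le> l" "l \<le> 1" "y = k ((1 - l) * t + l * x0) (l * (x0 - t))"
    by (auto simp: diagonal_values_def)
  have "(1 - l) * t + l * x0 \<le> (1 - l) * x0 + l * x0"
    using l assms by (intro add_right_mono mult_left_mono) auto
  then have "(1 - l) * t + l * x0 \<le> x0"
    by (simp add: algebra_simps)
  moreover have "l * (x0 - t) \<le> 1 * x0"
    using l assms by (intro mult_mono) auto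
  moreover have "0 \<le> (1 - l) * t + l * x0" "0 \<le> l * (x0 - t)"
    using l assms by auto
  ultimately show "y \<in> (\<lambda>(x, s). k x s) ` ({0..x0} \<times> {0..x0})"
    using l(3) by (intro image_eqI[where x = "((1 - l) * t + l * x0, l * (x0 - t))"]) auto
qed

lemma convolution_kernel_section:
  assumes "b \<in> borel_measurable (lebesgue_on {0..x0})" "0 \<le> x" "x \<le> x0"
  shows "convolution_kernel b x \<in> borel_measurable (lebesgue_on {0..x})"
proof -
  have "b \<in> borel_measurable (lebesgue_on {0..x})"
    by (rule measurable_restrict_mono[OF assms(1)]) (use assms in auto)
  then have "(\<lambda>t. indicator {0..x} t *\<^sub>R b t) \<in> borel_measurable lebesgue"
    by (subst (asm) borel_measurable_restrict_space_iff) auto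
  moreover have "(\<lambda>s. x + (-1) * s) \<in> lebesgue \<rightarrow>\<^sub>M lebesgue"
    using lebesgue_affine_measurable[where c = "\<lambda>_::real. -1" and t = x] by simp
  ultimately have "(\<lambda>s. indicator {0..x} (x + (-1) * s) *\<^sub>R b (x + (-1) * s))
      \<in> borel_measurable lebesgue"
    by (rule measurable_compose[rotated])
  also have "(\<lambda>s. indicator {0..x} (x + (-1) * s) *\<^sub>R b (x + (-1) * s))
      = (\<lambda>s. indicator {0..x} s *\<^sub>R convolution_kernel b x s)"
    by (auto simp: indicator_def convolution_kernel_def)
  finally show ?thesis
    by (subst borel_measurable_restrict_space_iff) auto
qed

text \<open>
  A single constant bounds both kernels, since every value of \<open>\<psi>\<close> is a value of \<open>k\<close> in the
  compact square \<open>[0, x0] \<times> [0, x0]\<close>.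
\<close>
lemma general_conditions_bounded_volterra:
  assumes gc: "general_conditions k g" and cb: "has_convolution_bounds k x0"
  obtains C where "joint_volterra k g x0 C" "convolution_volterra (psi k x0) g x0 C"
proof -
  have k_nonneg: "0 \<le> k x s" for x s
    using gc by (simp add: general_conditions_def)
  have "compact ({0..x0} \<times> {0..x0})"
    by (intro compact_Times) auto
  then have "bounded ((\<lambda>(x, s). k x s) ` ({0..x0} \<times> {0..x0}))"
    using gc unfolding general_conditions_def by blast
  then obtain C where C: "\<And>y. y \<in> (\<lambda>(x, s). k x s) ` ({0..x0} \<times> {0..x0}) \<Longrightarrow> \<bar>y\<bar> \<le> C"
    unfolding bounded_iff real_norm_def by blast
  have k_le: "k x s \<le> C" if "0 \<le> s" "s \<le> x" "x \<le> x0" for x s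
  proof -
    have "\<bar>k x s\<bar> \<le> C"
      using that by (intro C image_eqI[where x = "(x, s)"]) auto
    then show ?thesis by simp
  qed
  have psi_bounds: "0 \<le> psi k x0 t" "psi k x0 t \<le> C" if t: "0 \<le> t" "t \<le> x0" for t
  proof -
    have "k t 0 \<in> diagonal_values k x0 t"
      using kernel_value_on_diagonal[of 0 t x0 k] t by simp
    then have mem: "psi k x0 t \<in> diagonal_values k x0 t"
      by (rule phi_psi_extremal(4)[OF cb t])
    then show "0 \<le> psi k x0 t"
      using k_nonneg by (auto simp: diagonal_values_def)
    have "\<bar>psi k x0 t\<bar> \<le> C"
      using mem diagonal_values_subset[OF t] by (intro C) auto
    then show "psi k x0 t \<le> C" by simp
  qed
  have g_cont: "continuous_on UNIV g" and g_nonneg: "\<And>y. 0 \<le> g y"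
    and g_zero: "\<And>y. y \<le> 0 \<Longrightarrow> g y = 0" and g_strict: "strict_mono_on {0..} g"
    using gc by (auto simp: general_conditions_def)
  have g_mono: "g y \<le> g z" if "y \<le> z" for y z
  proof (cases "0 \<le> y")
    case True
    then show ?thesis
      using strict_mono_on_leD[OF g_strict] that by auto
  qed (use g_zero[of y] g_nonneg[of z] in auto)
  have k_section: "k x \<in> borel_measurable (lebesgue_on {0..x})" for x
  proof -
    have "set_integrable lebesgue {0..x} (\<lambda>s. k x s)"
      using gc unfolding general_conditions_def by (meson compact_Icc)
    then have "(\<lambda>s. indicator {0..x} s *\<^sub>R k x s) \<in> borel_measurable lebesgue"
      unfolding set_integrable_def by (rule borel_measurable_integrable)
    then show ?thesis
      by (subst borel_measurable_restrict_space_iff) auto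
  qed
  have psi_meas: "psi k x0 \<in> borel_measurable (lebesgue_on {0..x0})"
    using cb by (simp add: has_convolution_bounds_def)
  have "joint_volterra k g x0 C"
    using k_nonneg k_le k_section g_cont g_nonneg g_mono gc
    by unfold_locales (auto simp: general_conditions_def)
  moreover have "convolution_volterra (psi k x0) g x0 C"
    using psi_bounds convolution_kernel_section[OF psi_meas] g_cont g_nonneg g_mono
    by unfold_locales (auto simp: convolution_kernel_def)
  ultimately show ?thesis by (rule that)
qed

section \<open>Convergence to the extremal solutions\<close>
theorem theorem12:
  fixes k :: "real \<Rightarrow> real \<Rightarrow> real" and g :: "real \<Rightarrow> real" and x0 :: real
    and u_phi u_psi u_max u_min :: "real \<Rightarrow> real"
  assumes "general_conditions k g"
    and "0 < x0"
    and "has_convolution_bounds k x0"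
    and "unique_positive_solution (convolution_kernel (phi k x0)) g x0 u_phi"
    and "global_attractor (convolution_kernel (phi k x0)) g x0 u_phi"
    and "unique_positive_solution (convolution_kernel (psi k x0)) g x0 u_psi"
    and "global_attractor (convolution_kernel (psi k x0)) g x0 u_psi"
    and "maximum_solution k g x0 u_max"
    and "minimum_solution k g x0 u_min"
  shows "(\<forall>f. bounded_measurable_on x0 f \<and> (\<forall>x\<in>{0..x0}. u_max x \<le> f x) \<longrightarrow>
            (\<forall>x\<in>{0..x0}. (\<lambda>n. (volterra_op k g ^^ n) f x) \<longlonglongrightarrow> u_max x)) \<and>
         (\<forall>f. bounded_measurable_on x0 f \<and> positive_on x0 f \<and> (\<forall>x\<in>{0..x0}. f x \<le> u_min x) \<longrightarrow>
            (\<forall>x\<in>{0..x0}. (\<lambda>n. (volterra_op k g ^^ n) f x) \<longlonglongrightarrow> u_min x))"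
proof -
  obtain C where "joint_volterra k g x0 C" and psi_volterra: "convolution_volterra (psi k x0) g x0 C"
    using general_conditions_bounded_volterra[OF assms(1,3)] .
  then interpret joint_volterra k g x0 C by simp
  interpret psi: convolution_volterra "psi k x0" g x0 C by (rule psi_volterra)

  have phi_le: "convolution_kernel (phi k x0) x s \<le> k x s"
    and le_psi: "k x s \<le> convolution_kernel (psi k x0) x s"
    if "0 \<le> s" "s \<le> x" "x \<le> x0" for x s
    using phi_psi_extremal(1,2)[OF assms(3) _ _ kernel_value_on_diagonal[OF that]] that
    by (auto simp: convolution_kernel_def)

  (* The iterates of f lie below the psi-iterates of any positive constant that bounds f. *)
  have iterates_bounded: "\<exists>B. \<forall>n x. 0 \<le> x \<longrightarrow> x \<le> x0 \<longrightarrow> (T ^^ n) f x \<le> B"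
    if f: "bounded_measurable_on x0 f" for f
  proof -
    obtain M where M: "0 < M" "\<And>x. 0 \<le> x \<Longrightarrow> x \<le> x0 \<Longrightarrow> \<bar>f x\<bar> \<le> M"
      using bounded_measurable_onE[OF f] by metis
    have "bounded_measurable_on x0 (\<lambda>_. M)" "positive_on x0 (\<lambda>_. M)"
      using M(1) psi.convolution_iterates_of_constant[of 0 M] by (auto simp: positive_on_def)
    then have "(\<lambda>n. (psi.T ^^ n) (\<lambda>_. M) x0) \<longlonglongrightarrow> u_psi x0"
      using assms(2,7) by (auto simp: global_attractor_def)
    then obtain B where B: "\<And>n x. 0 \<le> x \<Longrightarrow> x \<le> x0 \<Longrightarrow> (psi.T ^^ n) (\<lambda>_. M) x \<le> B"
      using psi.convolution_iterates_bounded convergentI by metis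
    have "(T ^^ n) f x \<le> (psi.T ^^ n) (\<lambda>_. M) x" if "0 \<le> x" "x \<le> x0" for n x
    proof (rule psi.iterates_comparison)
      show "bounded_measurable_on x0 ((psi.T ^^ n) (\<lambda>_. M))" for n
        using psi.convolution_iterates_of_constant by blast
      show "f s \<le> M" if "0 \<le> s" "s \<le> x0" for s
        using M(2)[OF that] by simp
    qed (use le_psi that in auto)
    with B show ?thesis by (meson order_trans)
  qed

  have "positive_on x0 u_phi"
    using assms(4) by (simp add: unique_positive_solution_def positive_solution_def)
  then show ?thesis
    using iterates_tendsto_maximum_solution[OF iterates_bounded assms(8)]
      iterates_tendsto_minimum_solution[OF phi_le assms(5) _ assms(9)]
    by auto
qed

end
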